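(* Let $p \geq 1$ be an integer. Then for every integer $n \geq 1$, \[ F_n - n^{p} \;=\; \sum_{i=1}^{n} \left( i^{p} - 2\sum_{j=0}^{\lfloor p/2\rfloor} \binom{p}{2j+1} i^{p-2j-1} \right) F_{n-i}. \]
   Context: $F_n$ denotes the Fibonacci numbers: $F_0=0$, $F_1=1$, $F_n=F_{n-1}+F_{n-2}$ for $n>1$. Binomial coefficients $\binom{p}{m}$ with $m>p$ are $0$ (so terms with $2j+1>p$ vanish), and $i^0=1$. *)

theory Defs
  imports Main "HOL-Number_Theory.Fib"
begin

end

theory Submission
  imports Defs
begin

text \<open>By the binomial theorem the inner sum is \<open>(i + 1)^p - (i - 1)^p\<close>, so the weights of the
  convolution are \<open>g i + g (i - 1) - g (i + 1)\<close> for \<open>g i = i^p\<close>: the defect of \<open>g\<close> from the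
  Fibonacci recurrence. Convolving this defect with the Fibonacci numbers recovers \<open>fib n - g n\<close>.\<close>

lemma sum_lessThan_double:
  "(\<Sum>k<2 * m. f k) = (\<Sum>j<m. f (2 * j) + f (2 * j + 1))" for m :: nat
  by (induction m) (simp_all add: add.assoc)

text \<open>Expanding both powers, the factor \<open>1 - (- 1) ^ k\<close> kills even
  \<open>k\<close> and doubles odd \<open>k\<close>.\<close>

lemma binomial_odd_part:
  fixes x :: "'a::comm_ring_1"
  shows "2 * (\<Sum>j=0..p div 2. of_nat (p choose (2 * j + 1)) * x ^ (p - 2 * j - 1))
    = (x + 1) ^ p - (x - 1) ^ p"
proof -
  let ?f = "\<lambda>k. of_nat (p choose k) * (1 - (- 1) ^ k) * x ^ (p - k)"
  have "(x + 1) ^ p - (x - 1) ^ p = (1 + x) ^ p - (- 1 + x) ^ p"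
    by (simp add: add.commute)
  also have "\<dots> = (\<Sum>k\<le>p. ?f k)"
    unfolding binomial_ring sum_subtractf[symmetric]
    by (rule sum.cong) (simp_all add: algebra_simps)
  \<comment> \<open>An even range allows pairing; for even \<open>p\<close> it adds the index
    \<open>p + 1\<close>, where the binomial vanishes.\<close>
  also have "\<dots> = (\<Sum>k<2 * Suc (p div 2). ?f k)"
    by (intro sum.mono_neutral_left ballI subsetI) (simp_all add: not_le binomial_eq_0)
  also have "\<dots> = (\<Sum>j<Suc (p div 2). ?f (2 * j) + ?f (2 * j + 1))"
    by (rule sum_lessThan_double)
  also have "\<dots> = 2 * (\<Sum>j=0..p div 2. of_nat (p choose (2 * j + 1)) * x ^ (p - 2 * j - 1))"
    unfolding sum_distrib_left lessThan_Suc_atMost atMost_atLeast0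
    by (rule sum.cong) (simp_all add: mult_ac)
  finally show ?thesis by simp
qed

text \<open>Both sides satisfy the Fibonacci recurrence with the same extra term, the weight at
  \<open>n + 1\<close>; \<open>g 0 = 0\<close> settles the case \<open>n = 0\<close>.\<close>

lemma fib_convolution:
  fixes g :: "nat \<Rightarrow> 'a::comm_ring_1"
  assumes "g 0 = 0"
  shows "(\<Sum>i=1..n. (g i + g (i - 1) - g (i + 1)) * of_nat (fib (n - i)))
    = of_nat (fib n) * g 1 - g n"
proof (induction n rule: fib.induct)
  case (3 n)
  let ?w = "\<lambda>i. g i + g (i - 1) - g (i + 1)"
  let ?S = "\<lambda>n. \<Sum>i=1..n. ?w i * of_nat (fib (n - i))"
  have "(\<Sum>i=1..n. ?w i * of_nat (fib (Suc (Suc n) - i)))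
      = (\<Sum>i=1..n. ?w i * of_nat (fib (Suc n - i)) + ?w i * of_nat (fib (n - i)))"
    by (rule sum.cong) (simp_all add: Suc_diff_le distrib_left)
  \<comment> \<open>The last summand of \<open>?S (Suc n)\<close> and of
    \<open>?S (Suc (Suc n))\<close> carries \<open>fib 0 = 0\<close>; index \<open>Suc n\<close> of
    the latter carries \<open>fib 1 = 1\<close>.\<close>
  then have "?S (Suc (Suc n)) = ?S (Suc n) + ?S n + ?w (Suc n)"
    by (simp add: sum.distrib)
  also have "\<dots> = of_nat (fib (Suc (Suc n))) * g 1 - g (Suc (Suc n))"
    unfolding 3 by (simp add: algebra_simps)
  finally show ?case .
qed (simp_all add: assms)

theorem theorem1:
  fixes p n :: nat
  assumes "p \<ge> 1" and "n \<ge> 1"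
  shows "int (fib n) - int n ^ p =
    (\<Sum>i=1..n. (int i ^ p -
        2 * (\<Sum>j=0..p div 2. int (p choose (2 * j + 1)) * int i ^ (p - 2 * j - 1)))
      * int (fib (n - i)))"
proof -
  have "(\<Sum>i=1..n. (int i ^ p -
        2 * (\<Sum>j=0..p div 2. int (p choose (2 * j + 1)) * int i ^ (p - 2 * j - 1)))
      * int (fib (n - i)))
    = (\<Sum>i=1..n. (int i ^ p + int (i - 1) ^ p - int (i + 1) ^ p) * int (fib (n - i)))"
    \<comment> \<open>Since \<open>i\<close> starts at 1, the truncated \<open>i - 1\<close> is the
      integer difference.\<close>
    unfolding binomial_odd_part by (rule sum.cong) (simp_all add: of_nat_diff add.commute)
  also have "\<dots> = int (fib n) * int 1 ^ p - int n ^ p"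
    by (rule fib_convolution) (use assms in simp)
  finally show ?thesis by simp
qed

end
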